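(* Let $F(x)=f(x)+\delta_C(x)+\Phi(|x|)$ be as in the context, and let $\{\beta_k\}_{k\ge 0}\subset[0,1)$ satisfy $\sup_{k\ge 0}\beta_k<1$. Let $\{x^k\}$ be the sequence generated by the algorithm IRL$_1e_1$ described in the context, and let $H_1(x,y):=f(x)+\delta_C(x)+\Phi(|x|)+\frac{L}{2}\|x-y\|^2$. Then the following statements hold: (i) $\{H_1(x^k,x^{k-1})\}_{k\ge 0}$ is a nonincreasing convergent sequence. Moreover, there exists a positive constant $D_1$ such that for all $k\ge 0$, $$H_1(x^k,x^{k-1})-H_1(x^{k+1},x^k)\ge D_1\|x^k-x^{k-1}\|^2.$$ (ii) The sequence $\{x^k\}$ is bounded and $\lim_{k\to\infty}\|x^{k+1}-x^k\|=0$. (iii) Any accumulation point $\tilde x$ of $\{x^k\}$ is a stationary point of the problem $\min_{x\in\mathbb{R}^n}F(x)$, i.e., $0\in\partial F(\tilde x)$.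
   Context: Setting. $\mathbb{R}^n$ carries the Euclidean inner product $\langle\cdot,\cdot\rangle$ and norm $\|\cdot\|$. The function $f:\mathbb{R}^n\to\mathbb{R}$ is convex and continuously differentiable, and its gradient is Lipschitz continuous with modulus $L>0$. $C\subseteq\mathbb{R}^n$ is a nonempty closed convex set and $\delta_C$ is its indicator function ($0$ on $C$, $+\infty$ off $C$). $\Phi(y)=\sum_{i=1}^n\phi(y_i)$ for $y\in\mathbb{R}^n_+$, where $\phi:\mathbb{R}_+\to\mathbb{R}_+$ is a continuous concave function with $\phi(0)=0$ that is continuously differentiable on $(0,\infty)$ and such that the limit $\ell:=\lim_{t\downarrow 0}\phi'(t)$ exists (as a finite real number). For $x\in\mathbb{R}^n$, $|x|$ is the vector with entries $|x_i|$. It is assumed that $F(x):=f(x)+\delta_C(x)+\Phi(|x|)$ is level-bounded (all sets $\{x: F(x)\le\alpha\}$, $\alpha\in\mathbb{R}$, are bounded). Notation. $\phi'_+(t):=\lim_{h\downarrow 0}\frac{\phi(t+h)-\phi(t)}{h}$ is the right-hand derivative, and $\Phi'_+(|y|):=(\phi'_+(|y_1|),\dots,\phi'_+(|y_n|))$. For a proper function $g:\mathbb{R}^n\to(-\infty,\infty]$ and $x$ with $g(x)<\infty$, the regular subdifferential is $\hat\partial g(x)=\{\zeta:\liminf_{z\to x,z\ne x}\frac{g(z)-g(x)-\langle\zeta,z-x\rangle}{\|z-x\|}\ge 0\}$, and $\partial g(x)$ is the limiting subdifferential: the set of $\zeta$ for which there exist $x^k\to x$ with $g(x^k)\to g(x)$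 and $\zeta^k\in\hat\partial g(x^k)$ with $\zeta^k\to\zeta$; $\partial g(x)=\emptyset$ if $g(x)=\infty$. Algorithm IRL$_1e_1$. Start with $x^0=x^{-1}\in C$ and $\{\beta_k\}\subset[0,1)$. For $k=0,1,2,\dots$ (run without termination) set $s^{k+1}=\Phi'_+(|x^k|)$, $y^k=x^k+\beta_k(x^k-x^{k-1})$, and let $x^{k+1}$ be the unique minimizer over $y\in C$ of $\langle\nabla f(y^k),y-y^k\rangle+\frac{L}{2}\|y-y^k\|^2+\sum_{i=1}^n s^{k+1}_i|y_i|$. *)

theory Defs
  imports "HOL-Analysis.Analysis"
begin

definition indicator_fun :: "'a set \<Rightarrow> 'a \<Rightarrow> ereal" where
  "indicator_fun C x = (if x \<in> C then 0 else \<infinity>)"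

definition level_bounded :: "('a::real_normed_vector \<Rightarrow> ereal) \<Rightarrow> bool" where
  "level_bounded g \<longleftrightarrow> (\<forall>\<alpha>::real. bounded {x. g x \<le> ereal \<alpha>})"

(* Intended for proper g, i.e. g never -\<infinity> and not identically \<infinity>.
   The filter "at x" excludes the point x itself. *)
definition regular_subdifferential ::
  "('a::real_inner \<Rightarrow> ereal) \<Rightarrow> 'a \<Rightarrow> 'a set" where
  "regular_subdifferential g x =
     {\<zeta>. g x < \<infinity> \<and>
        Liminf (at x) (\<lambda>z. (g z - g x - ereal (\<zeta> \<bullet> (z - x))) / ereal (norm (z - x))) \<ge> 0}"

definition limiting_subdifferential ::
  "('a::real_inner \<Rightarrow> ereal) \<Rightarrow> 'a \<Rightarrow> 'a set" where
  "limiting_subdifferential g x =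
     {\<zeta>. g x < \<infinity> \<and>
        (\<exists>(u :: nat \<Rightarrow> 'a) \<xi>.
           u \<longlonglongrightarrow> x \<and> (\<lambda>k. g (u k)) \<longlonglongrightarrow> g x \<and>
           (\<forall>k. \<xi> k \<in> regular_subdifferential g (u k)) \<and> \<xi> \<longlonglongrightarrow> \<zeta>)}"

definition right_deriv :: "(real \<Rightarrow> real) \<Rightarrow> real \<Rightarrow> real" where
  "right_deriv \<phi> t = Lim (at_right 0) (\<lambda>h. (\<phi> (t + h) - \<phi> t) / h)"

(* \<Phi>. Only the values of \<phi> on {0..} matter: it is always applied to |x|,
   where \<bar>x\<bar> is the library's componentwise absolute value on real ^ 'n. *)
definition separable_sum :: "(real \<Rightarrow> real) \<Rightarrow> real ^ 'n \<Rightarrow> real" where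
  "separable_sum \<phi> y = (\<Sum>i\<in>UNIV. \<phi> (y $ i))"

definition right_deriv_vec :: "(real \<Rightarrow> real) \<Rightarrow> real ^ 'n \<Rightarrow> real ^ 'n" where
  "right_deriv_vec \<phi> y = (\<chi> i. right_deriv \<phi> (y $ i))"

definition objective ::
  "(real ^ 'n \<Rightarrow> real) \<Rightarrow> (real ^ 'n) set \<Rightarrow> (real \<Rightarrow> real) \<Rightarrow> real ^ 'n \<Rightarrow> ereal" where
  "objective f C \<phi> x = ereal (f x) + indicator_fun C x + ereal (separable_sum \<phi> \<bar>x\<bar>)"

definition H1 ::
  "(real ^ 'n \<Rightarrow> real) \<Rightarrow> (real ^ 'n) set \<Rightarrow> (real \<Rightarrow> real) \<Rightarrow> real
     \<Rightarrow> real ^ 'n \<Rightarrow> real ^ 'n \<Rightarrow> ereal" where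
  "H1 f C \<phi> L x y =
     ereal (f x) + indicator_fun C x + ereal (separable_sum \<phi> \<bar>x\<bar>)
       + ereal (L / 2 * (norm (x - y))\<^sup>2)"

definition subproblem_objective ::
  "real ^ 'n \<Rightarrow> real \<Rightarrow> real ^ 'n \<Rightarrow> real ^ 'n \<Rightarrow> real ^ 'n \<Rightarrow> real" where
  "subproblem_objective v L y s z =
     v \<bullet> (z - y) + L / 2 * (norm (z - y))\<^sup>2 + (\<Sum>i\<in>UNIV. s $ i * \<bar>z $ i\<bar>)"

(* Iterates are indexed by int so that the starting point x^{-1} is x (-1); values of x
   below -1 are irrelevant. The argument f' is the gradient of f. For L > 0 and s \<ge> 0 the subproblem
   objective is strongly convex, so its minimizer over C is unique and need not be assumed so. *)
definition IRL1e1 ::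
  "(real ^ 'n \<Rightarrow> real ^ 'n) \<Rightarrow> (real ^ 'n) set \<Rightarrow> (real \<Rightarrow> real) \<Rightarrow> real
     \<Rightarrow> (nat \<Rightarrow> real) \<Rightarrow> (int \<Rightarrow> real ^ 'n) \<Rightarrow> bool" where
  "IRL1e1 f' C \<phi> L \<beta> x \<longleftrightarrow>
     x 0 \<in> C \<and> x (- 1) = x 0 \<and>
     (\<forall>k::nat.
        let s = right_deriv_vec \<phi> \<bar>x (int k)\<bar>;
            y = x (int k) + \<beta> k *\<^sub>R (x (int k) - x (int k - 1))
        in is_arg_min (subproblem_objective (f' y) L y s) (\<lambda>z. z \<in> C) (x (int k + 1)))"

definition accumulation_point :: "(nat \<Rightarrow> 'a::topological_space) \<Rightarrow> 'a \<Rightarrow> bool" where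
  "accumulation_point u a \<longleftrightarrow> (\<exists>r :: nat \<Rightarrow> nat. strict_mono r \<and> (u \<circ> r) \<longlonglongrightarrow> a)"

end

theory Submission
  imports Defs
begin

text \<open>
  Two observations carry the proof.

  The first is that the potential \<open>f + \<Phi>(|.|) + L/2 \<parallel>x\<^sup>k - x\<^sup>k\<^sup>-\<^sup>1\<parallel>\<^sup>2\<close> decreases. A new iterate \<open>p\<close>
  minimizes over \<open>C\<close> a model that is \<open>L\<close>-strongly convex, so it beats the old iterate \<open>x\<close> in the model
  by at least \<open>L/2 \<parallel>x - p\<parallel>\<^sup>2\<close>. Three inequalities turn this into a statement about \<open>F\<close>: at \<open>p\<close>
  the quadratic model majorizes \<open>f\<close> because the gradient is Lipschitz; at \<open>x\<close> the linearization of \<open>f\<close>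
  minorizes \<open>f\<close> by convexity; and the weighted \<open>l\<^sub>1\<close> term, whose weights are the right derivatives of the
  concave \<open>\<phi>\<close> at \<open>|x|\<close>, majorizes the increment of \<open>\<Phi>\<close>. The only loss is
  \<open>L/2 \<parallel>x - y\<parallel>\<^sup>2 = L/2 \<beta>\<^sub>k\<^sup>2 \<parallel>x\<^sup>k - x\<^sup>k\<^sup>-\<^sup>1\<parallel>\<^sup>2\<close>, the price of extrapolating, and it is paid for by the
  quadratic term of the potential since the \<open>\<beta>\<^sub>k\<close> stay away from \<open>1\<close>
  (\<open>extrapolated_step_descent\<close>). The iterates therefore remain in a sublevel set of \<open>F\<close>, which
  is bounded; the potential is bounded below there, hence converges, and the steps vanish
  (\<open>sufficient_decrease\<close>).

  The second is that stationarity can be read off from the subproblem without subdifferential calculus.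
  Since \<open>\<phi>'\<close> has a finite limit at \<open>0\<close>, the right derivative \<open>\<phi>'\<^sub>+\<close> is continuous on \<open>[0,\<infinity>)\<close> and
  \<open>\<phi>\<close> is differentiable there relative to \<open>[0,\<infinity>)\<close>, the endpoint included. By continuity and because
  the steps vanish, an accumulation point \<open>a\<close> minimizes its own subproblem. The objective of that subproblem
  agrees with \<open>F\<close> on \<open>C\<close> near \<open>a\<close> up to an additive constant and \<open>o(\<parallel>z - a\<parallel>)\<close>, so \<open>F z \<ge> F a - o(\<parallel>z - a\<parallel>)\<close>: already the regular
  subdifferential of \<open>F\<close> at \<open>a\<close> contains \<open>0\<close> (\<open>subproblem_fixed_point_stationary\<close>).
\<close>

section \<open>Convex functions with Lipschitz gradient\<close>

lemma gradient_along_line: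
  assumes "\<And>z. GDERIV f z :> f' z"
  shows "((\<lambda>t. f (y + t *\<^sub>R d)) has_real_derivative f' (y + t *\<^sub>R d) \<bullet> d) (at t within S)"
proof -
  have "((\<lambda>t. y + t *\<^sub>R d) has_derivative (\<lambda>h. h *\<^sub>R d)) (at t within S)"
    by (auto intro!: derivative_eq_intros)
  moreover have "(f has_derivative (\<lambda>h. h \<bullet> f' (y + t *\<^sub>R d))) (at (y + t *\<^sub>R d))"
    using assms by (simp add: gderiv_def)
  ultimately have "((\<lambda>t. f (y + t *\<^sub>R d)) has_derivative (\<lambda>h. (h *\<^sub>R d) \<bullet> f' (y + t *\<^sub>R d)))
      (at t within S)"
    by (rule has_derivative_compose)
  then show ?thesis
    by (simp add: has_field_derivative_def inner_commute mult_commute_abs)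
qed

text \<open>
  Restricting to the line through \<open>y\<close> and \<open>z\<close> reduces this to the tangent inequality for convex
  functions of one real variable.
\<close>
lemma convex_on_imp_above_gradient:
  assumes "convex_on UNIV f" and grad: "\<And>z. GDERIV f z :> f' z"
  shows "f y + f' y \<bullet> (z - y) \<le> f z"
proof -
  define h where "h t = f (y + t *\<^sub>R (z - y))" for t :: real
  have "convex_on UNIV h"
  proof (rule convex_onI)
    fix t a b :: real
    assume "t > 0" "t < 1"
    have "y + ((1 - t) *\<^sub>R a + t *\<^sub>R b) *\<^sub>R (z - y)
        = (1 - t) *\<^sub>R (y + a *\<^sub>R (z - y)) + t *\<^sub>R (y + b *\<^sub>R (z - y))"
      by (simp add: algebra_simps)
    then show "h ((1 - t) *\<^sub>R a + t *\<^sub>R b) \<le> (1 - t) * h a + t * h b"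
      using convex_onD[OF assms(1), of t] \<open>t > 0\<close> \<open>t < 1\<close> by (simp add: h_def)
  qed simp
  moreover have "(h has_real_derivative f' y \<bullet> (z - y)) (at 0)"
    using gradient_along_line[OF grad, of y "z - y" 0 UNIV] by (simp add: h_def[abs_def])
  ultimately have "f' y \<bullet> (z - y) * (1 - 0) \<le> h 1 - h 0"
    by (intro convex_on_imp_above_tangent[where A = UNIV]) auto
  then show ?thesis by (simp add: h_def)
qed

text \<open>
  The descent lemma. Along the segment from \<open>y\<close> to \<open>z\<close>, the difference of the two sides has nonpositive
  derivative by Cauchy--Schwarz and the Lipschitz bound; this replaces the usual integral of the gradient.
\<close>
lemma lipschitz_gradient_upper_bound:
  assumes grad: "\<And>z. GDERIV f z :> f' z" and lip: "L-lipschitz_on UNIV f'"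
  shows "f z \<le> f y + f' y \<bullet> (z - y) + L / 2 * (norm (z - y))\<^sup>2"
proof -
  define d where "d = z - y"
  define h where "h t = f (y + t *\<^sub>R d) - t * (f' y \<bullet> d) - L / 2 * t\<^sup>2 * (norm d)\<^sup>2" for t :: real
  have "h 1 \<le> h 0"
  proof (rule DERIV_nonpos_imp_nonincreasing[where f = h])
    fix t :: real
    assume t: "0 \<le> t" "t \<le> 1"
    have "(h has_real_derivative (f' (y + t *\<^sub>R d) - f' y) \<bullet> d - L * t * (norm d)\<^sup>2) (at t)"
      unfolding h_def[abs_def]
      by (auto intro!: derivative_eq_intros gradient_along_line[OF grad] simp: inner_diff_left)
    moreover have "(f' (y + t *\<^sub>R d) - f' y) \<bullet> d \<le> L * t * (norm d)\<^sup>2"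
    proof -
      have "(f' (y + t *\<^sub>R d) - f' y) \<bullet> d \<le> norm (f' (y + t *\<^sub>R d) - f' y) * norm d"
        by (rule norm_cauchy_schwarz)
      also have "\<dots> \<le> (L * norm (t *\<^sub>R d)) * norm d"
        using lipschitz_onD[OF lip, of "y + t *\<^sub>R d" y]
        by (intro mult_right_mono) (auto simp: dist_norm)
      finally show ?thesis
        using t by (simp add: power2_eq_square mult_ac)
    qed
    ultimately show "\<exists>D. DERIV h t :> D \<and> D \<le> 0" by fastforce
  qed simp
  then show ?thesis by (simp add: h_def d_def)
qed

section \<open>Strongly convex subproblems\<close>

text \<open>
  Quadratic growth away from the minimizer. Comparing \<open>p\<close> with the point \<open>(1 - t) p + t z\<close> of the
  segment, convexity of \<open>h\<close> and the exact identity for the square give the bound with the growth term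
  scaled by \<open>1 - t\<close>, and \<open>t \<rightarrow> 0\<close> yields the claim.
\<close>
lemma strongly_convex_minimizer_growth:
  fixes h :: "'a::real_inner \<Rightarrow> real"
  assumes h: "convex_on C h" and p: "p \<in> C" and z: "z \<in> C"
    and min: "\<And>w. w \<in> C \<Longrightarrow> h p + L / 2 * (norm (p - y))\<^sup>2 \<le> h w + L / 2 * (norm (w - y))\<^sup>2"
  shows "h p + L / 2 * (norm (p - y))\<^sup>2 + L / 2 * (norm (z - p))\<^sup>2
    \<le> h z + L / 2 * (norm (z - y))\<^sup>2"
proof -
  define A where "A = h p + L / 2 * (norm (p - y))\<^sup>2"
  define B where "B = h z + L / 2 * (norm (z - y))\<^sup>2"
  define N where "N = (norm (z - p))\<^sup>2"
  have bound: "A + L / 2 * (1 - t) * N \<le> B" if t: "0 < t" "t < 1" for t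
  proof -
    define w where "w = (1 - t) *\<^sub>R p + t *\<^sub>R z"
    have "w \<in> C"
      using convexD_alt[OF convex_on_imp_convex[OF h] p z] t by (simp add: w_def)
    then have "A \<le> h w + L / 2 * (norm (w - y))\<^sup>2"
      using min by (simp add: A_def)
    also have "h w \<le> (1 - t) * h p + t * h z"
      using convex_onD[OF h _ _ p z] t by (simp add: w_def)
    also have "(norm (w - y))\<^sup>2
        = (1 - t) * (norm (p - y))\<^sup>2 + t * (norm (z - y))\<^sup>2 - t * (1 - t) * N"
      unfolding w_def N_def power2_norm_eq_inner
      by (simp add: inner_simps inner_commute algebra_simps)
    finally have "A \<le> (1 - t) * A + t * B - L / 2 * t * (1 - t) * N"
      unfolding A_def B_def
      by (auto simp: algebra_simps add_divide_distrib diff_divide_distrib)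
    then have "t * (A + L / 2 * (1 - t) * N) \<le> t * B"
      by (simp add: algebra_simps)
    then show ?thesis using t by simp
  qed
  have "((\<lambda>t. A + L / 2 * (1 - t) * N) \<longlongrightarrow> A + L / 2 * (1 - 0) * N) (at_right 0)"
    by (intro tendsto_intros)
  then have "A + L / 2 * (1 - 0) * N \<le> B"
  proof (rule tendsto_upperbound)
    show "\<forall>\<^sub>F t in at_right 0. A + L / 2 * (1 - t) * N \<le> B"
      using bound by (intro eventually_at_rightI[of 0 1]) auto
  qed simp
  then show ?thesis by (simp add: A_def B_def N_def)
qed

lemma convex_on_weighted_l1:
  fixes s :: "real ^ 'n"
  assumes s: "\<And>i. 0 \<le> s $ i" and C: "convex C"
  shows "convex_on C (\<lambda>z. v \<bullet> (z - y) + (\<Sum>i\<in>UNIV. s $ i * \<bar>z $ i\<bar>))"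
proof (rule convex_onI[OF _ C])
  fix t :: real and a b :: "real ^ 'n"
  assume t: "t > 0" "t < 1"
  have "(\<Sum>i\<in>UNIV. s $ i * \<bar>((1 - t) *\<^sub>R a + t *\<^sub>R b) $ i\<bar>)
      \<le> (\<Sum>i\<in>UNIV. (1 - t) * (s $ i * \<bar>a $ i\<bar>) + t * (s $ i * \<bar>b $ i\<bar>))"
  proof (rule sum_mono)
    fix i
    have "\<bar>(1 - t) * a $ i + t * b $ i\<bar> \<le> (1 - t) * \<bar>a $ i\<bar> + t * \<bar>b $ i\<bar>"
      using t abs_triangle_ineq[of "(1 - t) * a $ i" "t * b $ i"] by (simp add: abs_mult)
    then have "s $ i * \<bar>(1 - t) * a $ i + t * b $ i\<bar>
        \<le> s $ i * ((1 - t) * \<bar>a $ i\<bar> + t * \<bar>b $ i\<bar>)"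
      by (rule mult_left_mono) (rule s)
    then show "s $ i * \<bar>((1 - t) *\<^sub>R a + t *\<^sub>R b) $ i\<bar>
        \<le> (1 - t) * (s $ i * \<bar>a $ i\<bar>) + t * (s $ i * \<bar>b $ i\<bar>)"
      by (simp add: algebra_simps)
  qed
  moreover have "v \<bullet> ((1 - t) *\<^sub>R a + t *\<^sub>R b - y) = (1 - t) * (v \<bullet> (a - y)) + t * (v \<bullet> (b - y))"
    by (simp add: inner_simps algebra_simps)
  ultimately show "v \<bullet> ((1 - t) *\<^sub>R a + t *\<^sub>R b - y) + (\<Sum>i\<in>UNIV. s $ i * \<bar>((1 - t) *\<^sub>R a + t *\<^sub>R b) $ i\<bar>)
      \<le> (1 - t) * (v \<bullet> (a - y) + (\<Sum>i\<in>UNIV. s $ i * \<bar>a $ i\<bar>))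
        + t * (v \<bullet> (b - y) + (\<Sum>i\<in>UNIV. s $ i * \<bar>b $ i\<bar>))"
    by (simp add: sum.distrib sum_distrib_left distrib_left)
qed

section \<open>Concave penalties with finite slope at the origin\<close>

locale concave_penalty =
  fixes \<phi> :: "real \<Rightarrow> real" and ell :: real
  assumes nonneg: "\<And>t. t \<ge> 0 \<Longrightarrow> \<phi> t \<ge> 0"
    and cont: "continuous_on {0..} \<phi>"
    and concave: "concave_on {0..} \<phi>"
    and zero: "\<phi> 0 = 0"
    and diff: "\<And>t. t > 0 \<Longrightarrow> \<phi> differentiable (at t)"
    and C1: "continuous_on {0<..} (deriv \<phi>)"
    and limit: "(deriv \<phi> \<longlongrightarrow> ell) (at_right 0)"
begin

lemma DERIV_pos: "t > 0 \<Longrightarrow> DERIV \<phi> t :> deriv \<phi> t"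
  using diff DERIV_deriv_iff_real_differentiable by blast

lemma below_tangent_pos:
  assumes "t > 0" "u \<ge> 0"
  shows "\<phi> u \<le> \<phi> t + deriv \<phi> t * (u - t)"
proof -
  have "- deriv \<phi> t * (u - t) \<le> - \<phi> u - (- \<phi> t)"
  proof (rule convex_on_imp_above_tangent)
    show "convex_on {0..} (\<lambda>t. - \<phi> t)" using concave by (simp add: concave_on_def)
    show "((\<lambda>t. - \<phi> t) has_real_derivative - deriv \<phi> t) (at t within {0..})"
      using DERIV_pos[OF \<open>t > 0\<close>] by (intro DERIV_minus) (rule has_field_derivative_at_within)
  qed (use assms in \<open>auto simp: interior_Ici\<close>)
  then show ?thesis by simp
qed

lemma tendsto_zero: "(\<phi> \<longlongrightarrow> 0) (at_right 0)"
  using cont zero by (auto simp: continuous_on_def at_within_Ici_at_right dest!: bspec[of _ _ 0])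

text \<open>The boundary case is the limit, as \<open>t\<close> decreases to \<open>0\<close>, of the tangent inequalities at \<open>t > 0\<close>.\<close>
lemma below_tangent_zero:
  assumes "u \<ge> 0"
  shows "\<phi> u \<le> ell * u"
proof (rule tendsto_lowerbound)
  have "((\<lambda>t. \<phi> t + deriv \<phi> t * (u - t)) \<longlongrightarrow> 0 + ell * (u - 0)) (at_right 0)"
    by (intro tendsto_intros tendsto_zero limit)
  then show "((\<lambda>t. \<phi> t + deriv \<phi> t * (u - t)) \<longlongrightarrow> ell * u) (at_right 0)" by simp
  show "\<forall>\<^sub>F t in at_right 0. \<phi> u \<le> \<phi> t + deriv \<phi> t * (u - t)"
    using below_tangent_pos assms by (intro eventually_at_rightI[of 0 1]) auto
qed simp

text \<open>
  The tangent at \<open>h\<close>, evaluated at \<open>0\<close>, bounds the quotient from below by \<open>\<phi>' h\<close>; the tangent at \<open>0\<close>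
  bounds it from above by \<open>ell\<close>.
\<close>
lemma difference_quotient_zero: "((\<lambda>h. \<phi> h / h) \<longlongrightarrow> ell) (at_right 0)"
proof (rule tendsto_sandwich[OF _ _ limit tendsto_const])
  show "\<forall>\<^sub>F h in at_right 0. deriv \<phi> h \<le> \<phi> h / h"
    using below_tangent_pos[of _ 0] zero
    by (intro eventually_at_rightI[of 0 1]) (auto simp: field_simps)
  show "\<forall>\<^sub>F h in at_right 0. \<phi> h / h \<le> ell"
    using below_tangent_zero by (intro eventually_at_rightI[of 0 1]) (auto simp: field_simps)
qed

lemma right_deriv_zero: "right_deriv \<phi> 0 = ell"
  unfolding right_deriv_def using difference_quotient_zero zero by (intro tendsto_Lim) auto

lemma right_deriv_pos:
  assumes "t > 0"
  shows "right_deriv \<phi> t = deriv \<phi> t"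
  unfolding right_deriv_def
proof (rule tendsto_Lim)
  show "((\<lambda>h. (\<phi> (t + h) - \<phi> t) / h) \<longlongrightarrow> deriv \<phi> t) (at_right 0)"
    using DERIV_pos[OF assms] unfolding DERIV_def by (rule filterlim_mono) (auto intro: at_le)
qed simp

lemma has_right_deriv:
  assumes "t \<ge> 0"
  shows "(\<phi> has_real_derivative right_deriv \<phi> t) (at t within {0..})"
proof (cases "t = 0")
  case True
  then show ?thesis
    using difference_quotient_zero zero
    by (simp add: right_deriv_zero has_field_derivative_iff at_within_Ici_at_right)
next
  case False
  then show ?thesis
    using assms by (simp add: right_deriv_pos DERIV_pos has_field_derivative_at_within)
qed

lemma below_tangent:
  assumes "t \<ge> 0" "u \<ge> 0"
  shows "\<phi> u \<le> \<phi> t + right_deriv \<phi> t * (u - t)"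
  using assms below_tangent_pos below_tangent_zero zero
  by (cases "t = 0") (auto simp: right_deriv_zero right_deriv_pos)

text \<open>A tangent of negative slope would force the nonnegative function \<open>\<phi>\<close> below \<open>0\<close> far to the right.\<close>
lemma right_deriv_nonneg:
  assumes "t \<ge> 0"
  shows "right_deriv \<phi> t \<ge> 0"
proof (rule ccontr)
  assume "\<not> ?thesis"
  then have neg: "right_deriv \<phi> t < 0" by simp
  \<comment> \<open>the point where the tangent at \<open>t\<close> takes the value \<open>-1\<close>\<close>
  define u where "u = t + (\<phi> t + 1) / (- right_deriv \<phi> t)"
  have "u \<ge> 0" using neg assms nonneg[OF assms] by (auto simp: u_def intro!: add_nonneg_nonneg divide_nonneg_pos simp del: divide_minus_right)
  moreover have "\<phi> t + right_deriv \<phi> t * (u - t) = - 1"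
    using neg by (simp add: u_def field_simps)
  ultimately show False using below_tangent[OF assms \<open>u \<ge> 0\<close>] nonneg[of u] by simp
qed

lemma continuous_on_right_deriv: "continuous_on {0..} (right_deriv \<phi>)"
proof -
  have "(right_deriv \<phi> \<longlongrightarrow> right_deriv \<phi> t) (at t within {0..})" if "t \<ge> 0" for t
  proof (cases "t = 0")
    case True
    have "(right_deriv \<phi> \<longlongrightarrow> ell) (at_right 0)"
      using limit by (rule Lim_transform_eventually)
        (auto intro: eventually_at_rightI[of 0 1] simp: right_deriv_pos)
    then show ?thesis by (simp add: True right_deriv_zero at_within_Ici_at_right)
  next
    case False
    with that have t: "t \<in> {0<..}" by simp
    have "continuous_on {0<..} (right_deriv \<phi>)"
      using C1 by (rule continuous_on_eq) (simp add: right_deriv_pos)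
    then have "isCont (right_deriv \<phi>) t"
      using t by (simp add: continuous_on_eq_continuous_at)
    then show ?thesis unfolding isCont_def by (rule tendsto_within_subset) simp
  qed
  then show ?thesis by (simp add: continuous_on_def)
qed

end

section \<open>Stationarity from optimality in the subproblem\<close>

lemma zero_in_regular_subdifferentialI:
  assumes gx: "g x = ereal r"
    and low: "\<And>e. e > 0 \<Longrightarrow> \<forall>\<^sub>F z in at x. ereal (r - e * norm (z - x)) \<le> g z"
  shows "0 \<in> regular_subdifferential g x"
proof -
  have "\<forall>\<^sub>F z in at x. q < (g z - g x - ereal (0 \<bullet> (z - x))) / ereal (norm (z - x))"
    if "q < 0" for q
  proof -
    obtain e where e: "e > 0" "q < ereal (- e)"
    proof -
      obtain s where "q < ereal s" "ereal s < 0" using ereal_dense2[OF \<open>q < 0\<close>] by auto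
      then show ?thesis by (intro that[of "- s"]) auto
    qed
    have "\<forall>\<^sub>F z in at x. z \<noteq> x" by (simp add: eventually_at_filter)
    with low[OF e(1)] show ?thesis
    proof eventually_elim
      case (elim z)
      then have n: "norm (z - x) > 0" by simp
      have "ereal (- e) \<le> (g z - ereal r) / ereal (norm (z - x))"
      proof (cases "g z")
        case (real v)
        with elim n show ?thesis by (simp add: field_simps)
      qed (use elim n in auto)
      with e(2) show ?case by (simp add: gx)
    qed
  qed
  then show ?thesis
    by (auto simp: regular_subdifferential_def le_Liminf_iff gx)
qed

lemma regular_subset_limiting_subdifferential:
  "regular_subdifferential g x \<subseteq> limiting_subdifferential g x"
proof
  fix \<zeta> assume \<zeta>: "\<zeta> \<in> regular_subdifferential g x"
  then have "g x < \<infinity>" by (simp add: regular_subdifferential_def)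
  then show "\<zeta> \<in> limiting_subdifferential g x"
    unfolding limiting_subdifferential_def mem_Collect_eq
    using \<zeta> by (intro conjI exI[of _ "\<lambda>_. x"] exI[of _ "\<lambda>_. \<zeta>"]) auto
qed

lemma objective_eq:
  "x \<in> C \<Longrightarrow> objective f C \<phi> x = ereal (f x + separable_sum \<phi> \<bar>x\<bar>)"
  by (simp add: objective_def indicator_fun_def)

lemma H1_eq:
  "x \<in> C \<Longrightarrow> H1 f C \<phi> L x y = ereal (f x + separable_sum \<phi> \<bar>x\<bar> + L / 2 * (norm (x - y))\<^sup>2)"
  by (simp add: H1_def indicator_fun_def)

text \<open>
  On \<open>C\<close> the increments of \<open>f\<close> and of each \<open>\<phi> |z\<^sub>i|\<close> agree with the linear terms of the subproblem up to
  \<open>o(\<parallel>z - a\<parallel>)\<close>, and the proximal term is itself \<open>o(\<parallel>z - a\<parallel>)\<close>. Minimality of \<open>a\<close> in the subproblem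
  centred at \<open>a\<close> therefore becomes minimality in \<open>F\<close> up to first order. The kink of \<open>|z\<^sub>i|\<close> at \<open>0\<close> is
  harmless because it occurs identically on both sides: \<open>\<phi>\<close> is expanded in the variable \<open>|z\<^sub>i|\<close>.
\<close>
lemma subproblem_fixed_point_stationary:
  fixes a :: "real ^ 'n"
  assumes f: "GDERIV f a :> g" and a: "a \<in> C"
    and \<phi>: "\<And>i. (\<phi> has_real_derivative s $ i) (at \<bar>a $ i\<bar> within {0..})"
    and min: "\<And>z. z \<in> C \<Longrightarrow> subproblem_objective g L a s a \<le> subproblem_objective g L a s z"
  shows "0 \<in> regular_subdifferential (objective f C \<phi>) a"
proof (rule zero_in_regular_subdifferentialI[where g = "objective f C \<phi>" and x = a, OF objective_eq[OF a]])
  fix \<epsilon> :: real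
  assume "\<epsilon> > 0"
  \<comment> \<open>one share of the error for each coordinate, one for \<open>f\<close> and one for the proximal term\<close>
  define e where "e = \<epsilon> / (CARD('n) + 2)"
  have "e > 0" using \<open>\<epsilon> > 0\<close> by (simp add: e_def)
  moreover have "\<epsilon> = (CARD('n) + 2) * e" by (simp add: e_def)
  ultimately have e: "e > 0" "\<epsilon> = CARD('n) * e + 2 * e" by (simp_all add: distrib_right)
  have "(f has_derivative (\<lambda>h. h \<bullet> g)) (at a)"
    using f by (simp add: gderiv_def)
  then have ev_f: "\<forall>\<^sub>F z in at a. \<bar>f z - f a - (z - a) \<bullet> g\<bar> \<le> e * norm (z - a)"
    using e(1) by (simp add: has_derivative_within_alt2)
  have "\<forall>\<^sub>F z in at a. \<bar>\<phi> \<bar>z $ i\<bar> - \<phi> \<bar>a $ i\<bar> - s $ i * (\<bar>z $ i\<bar> - \<bar>a $ i\<bar>)\<bar> \<le> e * norm (z - a)" for i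
  proof -
    obtain d where d: "d > 0" "\<And>t. t \<ge> 0 \<Longrightarrow> \<bar>t - \<bar>a $ i\<bar>\<bar> < d \<Longrightarrow>
        \<bar>\<phi> t - \<phi> \<bar>a $ i\<bar> - s $ i * (t - \<bar>a $ i\<bar>)\<bar> \<le> e * \<bar>t - \<bar>a $ i\<bar>\<bar>"
      using \<phi>[of i] e(1) unfolding has_field_derivative_def has_derivative_within_alt by fastforce
    have "\<bar>\<phi> \<bar>z $ i\<bar> - \<phi> \<bar>a $ i\<bar> - s $ i * (\<bar>z $ i\<bar> - \<bar>a $ i\<bar>)\<bar> \<le> e * norm (z - a)"
      if "dist z a < d" for z
    proof -
      have le: "\<bar>\<bar>z $ i\<bar> - \<bar>a $ i\<bar>\<bar> \<le> norm (z - a)"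
        using component_le_norm_cart[of "z - a" i] by simp
      then have "\<bar>\<phi> \<bar>z $ i\<bar> - \<phi> \<bar>a $ i\<bar> - s $ i * (\<bar>z $ i\<bar> - \<bar>a $ i\<bar>)\<bar> \<le> e * \<bar>\<bar>z $ i\<bar> - \<bar>a $ i\<bar>\<bar>"
        using that by (intro d(2)) (auto simp: dist_norm)
      also have "\<dots> \<le> e * norm (z - a)" using le e(1) by (intro mult_left_mono) auto
      finally show ?thesis .
    qed
    then show ?thesis using d(1) unfolding eventually_at by blast
  qed
  then have ev_\<phi>: "\<forall>\<^sub>F z in at a. \<forall>i. \<bar>\<phi> \<bar>z $ i\<bar> - \<phi> \<bar>a $ i\<bar> - s $ i * (\<bar>z $ i\<bar> - \<bar>a $ i\<bar>)\<bar> \<le> e * norm (z - a)"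
    by (rule eventually_all_finite)
  have "((\<lambda>z. L / 2 * norm (z - a)) \<longlongrightarrow> L / 2 * norm (a - a)) (at a)"
    by (intro tendsto_intros)
  then have ev_L: "\<forall>\<^sub>F z in at a. L / 2 * norm (z - a) < e"
    using e(1) by (intro order_tendstoD) auto
  from ev_f ev_\<phi> ev_L
  show "\<forall>\<^sub>F z in at a. ereal (f a + separable_sum \<phi> \<bar>a\<bar> - \<epsilon> * norm (z - a)) \<le> objective f C \<phi> z"
  proof eventually_elim
    case (elim z)
    show ?case
    proof (cases "z \<in> C")
      case True
      have "(\<Sum>i\<in>UNIV. \<phi> \<bar>a $ i\<bar> + s $ i * (\<bar>z $ i\<bar> - \<bar>a $ i\<bar>) - e * norm (z - a)) \<le> (\<Sum>i\<in>UNIV. \<phi> \<bar>z $ i\<bar>)"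
        using elim(2) by (intro sum_mono) (smt (verit))
      then have \<Phi>: "separable_sum \<phi> \<bar>a\<bar> + (\<Sum>i\<in>UNIV. s $ i * \<bar>z $ i\<bar>) - (\<Sum>i\<in>UNIV. s $ i * \<bar>a $ i\<bar>)
          - CARD('n) * e * norm (z - a) \<le> separable_sum \<phi> \<bar>z\<bar>"
        by (simp add: separable_sum_def abs_vec_def sum.distrib sum_subtractf right_diff_distrib)
      have "(\<Sum>i\<in>UNIV. s $ i * \<bar>a $ i\<bar>)
          \<le> g \<bullet> (z - a) + L / 2 * (norm (z - a))\<^sup>2 + (\<Sum>i\<in>UNIV. s $ i * \<bar>z $ i\<bar>)"
        using min[OF True] by (simp add: subproblem_objective_def)
      moreover have "L / 2 * (norm (z - a))\<^sup>2 \<le> e * norm (z - a)"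
        using mult_right_mono[of "L / 2 * norm (z - a)" e "norm (z - a)"] elim(3)
        by (simp add: power2_eq_square mult_ac)
      ultimately have "f a + separable_sum \<phi> \<bar>a\<bar> - \<epsilon> * norm (z - a) \<le> f z + separable_sum \<phi> \<bar>z\<bar>"
        using \<Phi> elim(1) unfolding e(2) by (simp add: inner_commute distrib_right abs_le_iff)
      then show ?thesis by (simp add: objective_eq[OF True])
    next
      case False
      then show ?thesis by (simp add: objective_def indicator_fun_def)
    qed
  qed
qed

text \<open>
  Along a subsequence converging to \<open>a\<close>, the successors \<open>X (Suc k)\<close> and the centres \<open>y k\<close> converge to
  \<open>a\<close> as well, and the data of the subproblems converge by continuity of \<open>f'\<close> and of \<open>right_deriv \<phi>\<close>.
  Passing to the limit in the minimality inequalities shows that \<open>a\<close> solves its own subproblem.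
\<close>
lemma accumulation_point_of_close_minimizers_stationary:
  fixes X y :: "nat \<Rightarrow> real ^ 'n"
  assumes pen: "concave_penalty \<phi> ell"
    and grad: "\<And>z. GDERIV f z :> f' z" and f': "continuous_on UNIV f'"
    and C: "closed C" and XC: "\<And>k. X k \<in> C"
    and min: "\<And>k. is_arg_min
        (subproblem_objective (f' (y k)) L (y k) (right_deriv_vec \<phi> \<bar>X k\<bar>)) (\<lambda>z. z \<in> C) (X (Suc k))"
    and close: "(\<lambda>k. X (Suc k) - X k) \<longlonglongrightarrow> 0" "(\<lambda>k. y k - X k) \<longlonglongrightarrow> 0"
    and a: "accumulation_point X a"
  shows "0 \<in> regular_subdifferential (objective f C \<phi>) a"
proof -
  interpret concave_penalty \<phi> ell by (rule pen)
  obtain r where r: "strict_mono r" and Xr: "(\<lambda>j. X (r j)) \<longlonglongrightarrow> a"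
    using a by (auto simp: accumulation_point_def o_def)
  have near: "(\<lambda>j. u (r j)) \<longlonglongrightarrow> a" if "(\<lambda>k. u k - X k) \<longlonglongrightarrow> 0" for u
    using tendsto_add[OF LIMSEQ_subseq_LIMSEQ[OF that r] Xr] by (simp add: o_def)
  have pr: "(\<lambda>j. X (Suc (r j))) \<longlonglongrightarrow> a" using near[OF close(1)] .
  have yr: "(\<lambda>j. y (r j)) \<longlonglongrightarrow> a" using near[OF close(2)] .
  have gr: "(\<lambda>j. f' (y (r j))) \<longlonglongrightarrow> f' a"
    using f' yr by (auto intro: continuous_on_tendsto_compose)
  have sr: "(\<lambda>j. right_deriv_vec \<phi> \<bar>X (r j)\<bar>) \<longlonglongrightarrow> right_deriv_vec \<phi> \<bar>a\<bar>"
  proof (rule vec_tendstoI)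
    show "(\<lambda>j. right_deriv_vec \<phi> \<bar>X (r j)\<bar> $ i) \<longlonglongrightarrow> right_deriv_vec \<phi> \<bar>a\<bar> $ i" for i
      unfolding right_deriv_vec_def abs_vec_def vec_lambda_beta
      by (rule continuous_on_tendsto_compose[OF continuous_on_right_deriv])
        (auto intro!: tendsto_intros Xr)
  qed
  have aC: "a \<in> C"
    by (rule closed_sequentially[OF C _ Xr]) (rule XC)
  show ?thesis
  proof (rule subproblem_fixed_point_stationary[OF grad aC])
    show "(\<phi> has_real_derivative right_deriv_vec \<phi> \<bar>a\<bar> $ i) (at \<bar>a $ i\<bar> within {0..})" for i
      by (simp add: right_deriv_vec_def abs_vec_def has_right_deriv)
    fix z assume z: "z \<in> C"
    have lim: "(\<lambda>j. subproblem_objective (f' (y (r j))) L (y (r j)) (right_deriv_vec \<phi> \<bar>X (r j)\<bar>) (q j))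
        \<longlonglongrightarrow> subproblem_objective (f' a) L a (right_deriv_vec \<phi> \<bar>a\<bar>) q'" if "q \<longlonglongrightarrow> q'" for q q'
      unfolding subproblem_objective_def
      by (intro tendsto_intros gr yr sr that)
    show "subproblem_objective (f' a) L a (right_deriv_vec \<phi> \<bar>a\<bar>) a
        \<le> subproblem_objective (f' a) L a (right_deriv_vec \<phi> \<bar>a\<bar>) z"
      using min z
      by (intro LIMSEQ_le[OF lim[OF pr] lim[OF tendsto_const[of z]]])
        (auto simp: is_arg_min_linorder)
  qed
qed

section \<open>Descent and convergence\<close>

text \<open>
  Adds up the growth of the subproblem away from \<open>p\<close>, the descent lemma at \<open>p\<close>, the gradient
  inequality at \<open>x\<close> and the majorization of \<open>\<phi>\<close> by its tangents; the terms in \<open>f' y\<close>, \<open>s\<close> and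
  \<open>\<parallel>p - y\<parallel>\<^sup>2\<close> cancel.
\<close>
lemma extrapolated_step_descent:
  fixes x y p s :: "real ^ 'n"
  assumes f: "convex_on UNIV f" and grad: "\<And>z. GDERIV f z :> f' z"
    and lip: "L-lipschitz_on UNIV f'"
    and C: "convex C" and x: "x \<in> C" and s: "\<And>i. 0 \<le> s $ i"
    and tangent: "\<And>i. \<phi> \<bar>p $ i\<bar> \<le> \<phi> \<bar>x $ i\<bar> + s $ i * (\<bar>p $ i\<bar> - \<bar>x $ i\<bar>)"
    and p: "is_arg_min (subproblem_objective (f' y) L y s) (\<lambda>z. z \<in> C) p"
  shows "f p + separable_sum \<phi> \<bar>p\<bar> + L / 2 * (norm (p - x))\<^sup>2
    \<le> f x + separable_sum \<phi> \<bar>x\<bar> + L / 2 * (norm (x - y))\<^sup>2"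
proof -
  define h where "h z = f' y \<bullet> (z - y) + (\<Sum>i\<in>UNIV. s $ i * \<bar>z $ i\<bar>)" for z
  have growth: "h p + L / 2 * (norm (p - y))\<^sup>2 + L / 2 * (norm (x - p))\<^sup>2
      \<le> h x + L / 2 * (norm (x - y))\<^sup>2"
  proof (rule strongly_convex_minimizer_growth[OF _ _ x])
    show "convex_on C h"
      using convex_on_weighted_l1[OF s C] by (simp add: h_def[abs_def])
  qed (use p in \<open>simp_all add: is_arg_min_linorder subproblem_objective_def h_def add_ac\<close>)
  have "(\<Sum>i\<in>UNIV. \<phi> \<bar>p $ i\<bar>) \<le> (\<Sum>i\<in>UNIV. \<phi> \<bar>x $ i\<bar> + s $ i * (\<bar>p $ i\<bar> - \<bar>x $ i\<bar>))"
    by (intro sum_mono tangent)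
  then have "separable_sum \<phi> \<bar>p\<bar> \<le> separable_sum \<phi> \<bar>x\<bar>
      + (\<Sum>i\<in>UNIV. s $ i * \<bar>p $ i\<bar>) - (\<Sum>i\<in>UNIV. s $ i * \<bar>x $ i\<bar>)"
    by (simp add: separable_sum_def abs_vec_def sum.distrib sum_subtractf right_diff_distrib)
  then show ?thesis
    using growth convex_on_imp_above_gradient[OF f grad, of y x]
      lipschitz_gradient_upper_bound[OF grad lip, of p y]
    by (simp add: h_def norm_minus_commute)
qed

lemma sufficient_decrease:
  fixes E d :: "nat \<Rightarrow> real"
  assumes D: "D > 0" and dec: "\<And>k. D * (d k)\<^sup>2 \<le> E k - E (Suc k)" and low: "\<And>k. B \<le> E k"
  shows "decseq E" "convergent E" "d \<longlonglongrightarrow> 0"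
proof -
  have "E (Suc k) \<le> E k" for k
    using dec[of k] D zero_le_power2[of "d k"] by (smt (verit) mult_nonneg_nonneg)
  then show "decseq E" by (rule decseq_SucI)
  then obtain h where h: "E \<longlonglongrightarrow> h" using decseq_convergent low by metis
  then show "convergent E" by (rule convergentI)
  have "(\<lambda>k. (E k - E (Suc k)) / D) \<longlonglongrightarrow> (h - h) / D"
    using D by (intro tendsto_intros h LIMSEQ_Suc) auto
  then have "(\<lambda>k. (d k)\<^sup>2) \<longlonglongrightarrow> 0"
    using dec D
    by (intro tendsto_sandwich[OF _ _ tendsto_const[of 0], of "\<lambda>k. (d k)\<^sup>2" _ "\<lambda>k. (E k - E (Suc k)) / D"])
      (auto simp: field_simps)
  then show "d \<longlonglongrightarrow> 0" by simp
qed

theorem theorem3p1: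
  fixes f :: "real ^ 'n \<Rightarrow> real"
    and f' :: "real ^ 'n \<Rightarrow> real ^ 'n"
    and C :: "(real ^ 'n) set"
    and \<phi> :: "real \<Rightarrow> real"
    and \<beta> :: "nat \<Rightarrow> real"
    and L ell :: real
    and x :: "int \<Rightarrow> real ^ 'n"
  assumes f_convex: "convex_on UNIV f"
    and f_gradient: "\<And>z. GDERIV f z :> f' z"
    and f_C1: "continuous_on UNIV f'"
    and L_pos: "L > 0"
    and f_Lipschitz: "L-lipschitz_on UNIV f'"
    and C_nonempty: "C \<noteq> {}"
    and C_closed: "closed C"
    and C_convex: "convex C"
    and phi_nonneg: "\<And>t. t \<ge> 0 \<Longrightarrow> \<phi> t \<ge> 0"
    and phi_cont: "continuous_on {0..} \<phi>"
    and phi_concave: "concave_on {0..} \<phi>"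
    and phi_zero: "\<phi> 0 = 0"
    and phi_diff: "\<And>t. t > 0 \<Longrightarrow> \<phi> differentiable (at t)"
    and phi_C1: "continuous_on {0<..} (deriv \<phi>)"
    and phi_limit: "(deriv \<phi> \<longlongrightarrow> ell) (at_right 0)"
    and F_level_bounded: "level_bounded (objective f C \<phi>)"
    and beta_range: "\<And>k. \<beta> k \<in> {0..<1}"
    and beta_sup: "(SUP k. \<beta> k) < 1"
    and algorithm: "IRL1e1 f' C \<phi> L \<beta> x"
  shows
    \<comment> \<open>(i)\<close>
    "((\<forall>k::nat. \<bar>H1 f C \<phi> L (x (int k)) (x (int k - 1))\<bar> \<noteq> \<infinity>) \<and>
      decseq (\<lambda>k::nat. H1 f C \<phi> L (x (int k)) (x (int k - 1))) \<and>
      (\<exists>h::real. (\<lambda>k::nat. H1 f C \<phi> L (x (int k)) (x (int k - 1))) \<longlonglongrightarrow> ereal h) \<and>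
      (\<exists>D1::real. D1 > 0 \<and>
         (\<forall>k::nat. H1 f C \<phi> L (x (int k)) (x (int k - 1))
                    - H1 f C \<phi> L (x (int k + 1)) (x (int k))
                  \<ge> ereal (D1 * (norm (x (int k) - x (int k - 1)))\<^sup>2)))) \<and>
    \<comment> \<open>(ii)\<close>
     (bounded (range (\<lambda>k::nat. x (int k))) \<and>
      (\<lambda>k::nat. norm (x (int k + 1) - x (int k))) \<longlonglongrightarrow> 0) \<and>
    \<comment> \<open>(iii)\<close>
     (\<forall>a. accumulation_point (\<lambda>k::nat. x (int k)) a \<longrightarrow>
        0 \<in> limiting_subdifferential (objective f C \<phi>) a)"
proof -
  interpret concave_penalty \<phi> ell
    by unfold_locales (fact phi_nonneg phi_cont phi_concave phi_zero phi_diff phi_C1 phi_limit)+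
  define X where "X k = x (int k)" for k
  define P where "P k = x (int k - 1)" for k
  define y where "y k = X k + \<beta> k *\<^sub>R (X k - P k)" for k
  define s where "s k = right_deriv_vec \<phi> \<bar>X k\<bar>" for k
  define E where "E k = f (X k) + separable_sum \<phi> \<bar>X k\<bar> + L / 2 * (norm (X k - P k))\<^sup>2" for k
  have X_Suc: "x (int k + 1) = X (Suc k)" for k by (simp add: X_def add.commute)
  have P_Suc: "P (Suc k) = X k" for k by (simp add: X_def P_def)
  have step: "is_arg_min (subproblem_objective (f' (y k)) L (y k) (s k)) (\<lambda>z. z \<in> C) (X (Suc k))" for k
    using algorithm unfolding IRL1e1_def Let_def y_def s_def P_def X_Suc[symmetric]
    by (simp add: X_def)
  have start: "X 0 \<in> C"
    using algorithm by (simp add: IRL1e1_def X_def)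
  have XC: "X k \<in> C" for k
    using start step by (cases k) (auto simp: is_arg_min_def)
  have H: "H1 f C \<phi> L (x (int k)) (x (int k - 1)) = ereal (E k)" for k
    using H1_eq[OF XC] by (simp add: E_def X_def P_def)
  have H_Suc: "H1 f C \<phi> L (x (int k + 1)) (x (int k)) = ereal (E (Suc k))" for k
    using H[of "Suc k"] by (simp add: add.commute)

  define b where "b = (SUP k. \<beta> k)"
  have \<beta>: "0 \<le> \<beta> k" "\<beta> k \<le> 1" for k using beta_range[of k] by auto
  have \<beta>_le: "\<beta> k \<le> b" for k
    unfolding b_def using \<beta> by (intro cSUP_upper bdd_aboveI2) auto
  have "0 \<le> b" using \<beta>(1)[of 0] \<beta>_le[of 0] by simp
  have "b < 1" using beta_sup by (simp add: b_def)
  \<comment> \<open>extrapolation costs at most the fraction \<open>b\<^sup>2\<close> of the quadratic term in \<open>E k\<close>; the rest is gained\<close>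
  define D where "D = L / 2 * (1 - b\<^sup>2)"
  have D: "D > 0"
    using L_pos \<open>0 \<le> b\<close> \<open>b < 1\<close> by (simp add: D_def abs_square_less_1)

  have decrease: "D * (norm (X k - P k))\<^sup>2 \<le> E k - E (Suc k)" for k
  proof -
    have "E (Suc k) \<le> f (X k) + separable_sum \<phi> \<bar>X k\<bar> + L / 2 * (norm (X k - y k))\<^sup>2"
      unfolding E_def P_Suc
      by (rule extrapolated_step_descent[OF f_convex f_gradient f_Lipschitz C_convex XC _ _ step])
        (simp_all add: s_def right_deriv_vec_def abs_vec_def right_deriv_nonneg below_tangent)
    also have "norm (X k - y k) = \<beta> k * norm (X k - P k)"
      using \<beta>(1) by (simp add: y_def)
    finally have "E (Suc k) \<le> E k - L / 2 * (1 - (\<beta> k)\<^sup>2) * (norm (X k - P k))\<^sup>2"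
      by (simp add: E_def power_mult_distrib algebra_simps diff_divide_distrib)
    moreover have "D * (norm (X k - P k))\<^sup>2 \<le> L / 2 * (1 - (\<beta> k)\<^sup>2) * (norm (X k - P k))\<^sup>2"
      unfolding D_def using L_pos \<beta>(1) \<beta>_le by (intro mult_right_mono mult_left_mono) (auto intro: power_mono)
    ultimately show ?thesis by simp
  qed

  have E_le: "E k \<le> E 0" for k
  proof (induction k)
    case (Suc k)
    have "0 \<le> D * (norm (X k - P k))\<^sup>2" using D by simp
    with decrease[of k] Suc show ?case by simp
  qed simp
  have "range X \<subseteq> {z. objective f C \<phi> z \<le> ereal (E 0)}"
  proof clarify
    fix k
    have "f (X k) + separable_sum \<phi> \<bar>X k\<bar> \<le> E k" using L_pos by (simp add: E_def)
    then show "objective f C \<phi> (X k) \<le> ereal (E 0)"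
      using E_le[of k] by (simp add: objective_eq[OF XC])
  qed
  then have bdd: "bounded (range X)"
    using F_level_bounded bounded_subset unfolding level_bounded_def by blast

  have "continuous_on UNIV f"
    using f_gradient unfolding gderiv_def
    by (intro continuous_at_imp_continuous_on ballI) (blast intro: has_derivative_continuous)
  then have "bounded (f ` closure (range X))"
    using bdd by (intro compact_imp_bounded compact_continuous_image)
      (auto intro: continuous_on_subset)
  then obtain B where B: "\<And>z. z \<in> closure (range X) \<Longrightarrow> \<bar>f z\<bar> \<le> B"
    by (auto simp: bounded_iff)
  have low: "- B \<le> E k" for k
  proof -
    have "X k \<in> closure (range X)" using closure_subset[of "range X"] by auto
    moreover have "0 \<le> separable_sum \<phi> \<bar>X k\<bar>"
      by (auto simp: separable_sum_def abs_vec_def intro!: sum_nonneg nonneg)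
    moreover have "0 \<le> L / 2 * (norm (X k - P k))\<^sup>2" using L_pos by simp
    ultimately show ?thesis using B[of "X k"] by (simp add: E_def)
  qed

  note descent = sufficient_decrease[of D "\<lambda>k. norm (X k - P k)" E, OF D decrease low]
  obtain h where h: "E \<longlonglongrightarrow> h" using descent(2) by (auto simp: convergent_def)
  have step0: "(\<lambda>k. norm (X (Suc k) - X k)) \<longlonglongrightarrow> 0"
    using LIMSEQ_Suc[OF descent(3)] by (simp add: P_Suc)
  have "(\<lambda>k. y k - X k) \<longlonglongrightarrow> 0"
  proof (rule Lim_null_comparison[OF _ descent(3)])
    show "\<forall>\<^sub>F k in sequentially. norm (y k - X k) \<le> norm (X k - P k)"
      using \<beta> by (auto simp: y_def intro!: always_eventually mult_left_le_one_le)
  qed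
  then have stationary: "0 \<in> limiting_subdifferential (objective f C \<phi>) a"
    if "accumulation_point X a" for a
    using that step step0 XC
    by (intro subsetD[OF regular_subset_limiting_subdifferential]
        accumulation_point_of_close_minimizers_stationary[OF concave_penalty_axioms f_gradient f_C1 C_closed])
      (auto simp: s_def tendsto_norm_zero_iff)

  show ?thesis
  proof (intro conjI allI impI)
    show "\<bar>H1 f C \<phi> L (x (int k)) (x (int k - 1))\<bar> \<noteq> \<infinity>" for k :: nat
      by (simp add: H)
    show "decseq (\<lambda>k::nat. H1 f C \<phi> L (x (int k)) (x (int k - 1)))"
      using descent(1) by (simp add: H decseq_def)
    show "\<exists>h::real. (\<lambda>k::nat. H1 f C \<phi> L (x (int k)) (x (int k - 1))) \<longlonglongrightarrow> ereal h"
      using h by (auto simp: H)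
    show "\<exists>D1>0. \<forall>k::nat. ereal (D1 * (norm (x (int k) - x (int k - 1)))\<^sup>2)
        \<le> H1 f C \<phi> L (x (int k)) (x (int k - 1)) - H1 f C \<phi> L (x (int k + 1)) (x (int k))"
      using D decrease by (intro exI[of _ D]) (simp add: H H_Suc X_def P_def)
    show "bounded (range (\<lambda>k::nat. x (int k)))"
      using bdd by (simp add: X_def[abs_def])
    show "(\<lambda>k::nat. norm (x (int k + 1) - x (int k))) \<longlonglongrightarrow> 0"
      using step0 by (simp add: X_Suc) (simp add: X_def)
    show "0 \<in> limiting_subdifferential (objective f C \<phi>) a"
      if "accumulation_point (\<lambda>k::nat. x (int k)) a" for a
      using stationary that by (simp add: X_def[abs_def])
  qed
qed

end
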